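(* Let $C=\times_{i\in I}C_i\subset\mathcal H$ be a product of $m$ nonempty compact convex sets with diameter $D$, and let $f\colon\mathcal H\to\mathbb R$ be such that $\nabla f$ is $L_f$-Lipschitz continuous on $C$. Let $(\boldsymbol x_t)_{t\in\mathbb N}$ be generated by Short-Step Block-Coordinate Frank-Wolfe (described in the context), and suppose the positive integer $K$ satisfies $I=\bigcup_{k=t}^{t+K-1}I_k$ for every $t\in\mathbb N$. Set $H_0=f(\boldsymbol x_0)-\inf_{\boldsymbol x\in C}f(\boldsymbol x)$ and, for every $n\in\mathbb N$, $$A_n=\sum_{k=1}^{K-1}G_{I_{n+k-1}\cap(I_{n+k}\cup\cdots\cup I_{n+K-1})}(\boldsymbol x_{n+k})\ge0.$$ Then, for every $n\in\mathbb N\setminus\{0\}$, $$\min_{0\le p\le n-1}G_I(\boldsymbol x_{pK})\le\frac1n\sum_{p=0}^{n-1}G_I(\boldsymbol x_{pK})\le\begin{cases}\displaystyle\frac{2H_0-\sum_{p=0}^{n-1}A_{pK}}{n}+\frac{KL_fD^2}{2}&\text{if }n\le\dfrac{2H_0}{KL_fD^2},\\[1em]\displaystyle2D\sqrt{\frac{H_0KL_f}{n}}-\frac{\sum_{p=0}^{n-1}A_{pK}}{n}&\text{otherwise.}\end{cases}$$ In consequence, there exists a subsequence $(n_k)_{k\in\mathbb N}$ such that $G_I(\boldsymbol x_{n_kK})\to0$, and every accumulation point of $(\boldsymbol x_{n_kK})_{k\in\mathbb N}$ is a stationary point of the problem of minimizing $f$ over $C$.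
   Context: Notation. $I=\{1,\dots,m\}$; $\mathcal H=\bigoplus_{i\in I}\mathcal H_i$ is the direct sum of real Hilbert spaces with $\langle\boldsymbol x\mid\boldsymbol y\rangle=\sum_i\langle\boldsymbol x^i\mid\boldsymbol y^i\rangle$; the $\mathcal H_i$ are treated as orthogonal subspaces, so $\boldsymbol x=\sum_{i\in I}\boldsymbol x^i$ with $\boldsymbol x^i\in\mathcal H_i$, and $\boldsymbol x^J=\sum_{i\in J}\boldsymbol x^i$ for $J\subset I$. $C_i\subset\mathcal H_i$ is nonempty, compact, convex; $\times_{i\in J}C_i$ is the set of $\boldsymbol x\in\mathcal H$ with $\boldsymbol x^i\in C_i$ for $i\in J$ and $\boldsymbol x^i=0$ for $i\notin J$; $C=\times_{i\in I}C_i$. $f$ is Fréchet differentiable, $L_f>0$. $\nabla^Jf(\boldsymbol x)=(\nabla f(\boldsymbol x))^J$. The linear minimization oracle $\mathrm{LMO}_J(\boldsymbol c)$ returns a point in $\operatorname{Argmin}_{\boldsymbol v\in\times_{i\in J}C_i}\langle\boldsymbol c^J\mid\boldsymbol v\rangle$, with $\mathrm{LMO}_i=\mathrm{LMO}_{\{i\}}$. The partial Frank-Wolfe gap is $G_J(\boldsymbol x)=\langle\nabla^Jf(\boldsymbol x)\mid\boldsymbol x^J-\mathrm{LMO}_J(\nabla^Jf(\boldsymbol x))\rangle$ for $\boldsymbol x\in C$, with $G_\varnothing=0$; the Frank-Wolfe gap is $G_I(\boldsymbol x)=\sup_{\boldsymbol v\in C}\langle\nabla f(\boldsymbol x)\mid\boldsymbol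 x-\boldsymbol v\rangle$. A point $\boldsymbol x$ is a stationary point of minimizing $f$ over $C$ iff $\boldsymbol x\in C$ and $G_I(\boldsymbol x)\le0$. Short-Step Block-Coordinate Frank-Wolfe. Input: $\boldsymbol x_0\in C$. For $t=0,1,2,\dots$: choose a nonempty block $I_t\subset I$; set $\boldsymbol g_t=\nabla f(\boldsymbol x_t)$; for $i\in I_t$ set $\boldsymbol v_t^i=\mathrm{LMO}_i(\boldsymbol g_t^i)$, $\gamma_t^i=\min\{1,\langle\boldsymbol g_t^i\mid\boldsymbol x_t^i-\boldsymbol v_t^i\rangle/(L_f\|\boldsymbol v_t^i-\boldsymbol x_t^i\|^2)\}$ and $\boldsymbol x_{t+1}^i=\boldsymbol x_t^i+\gamma_t^i(\boldsymbol v_t^i-\boldsymbol x_t^i)$ (if $\boldsymbol x_t^i=\boldsymbol v_t^i$, the component is unchanged whatever the value of $\gamma_t^i$); for $i\notin I_t$ set $\boldsymbol x_{t+1}^i=\boldsymbol x_t^i$. *)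

theory Defs
  imports "HOL-Analysis.Analysis"
begin

text \<open>
  The direct sum is internal: the ambient Hilbert space is a type, and the summands \<open>H i\<close>
  (\<open>i \<in> I\<close>) are closed, pairwise orthogonal subspaces that together span it. The identity
  \<open>x \<bullet> y = (\<Sum>i\<in>I. x\<^sup>i \<bullet> y\<^sup>i)\<close> for the components of \<open>x\<close> and \<open>y\<close> then holds automatically.
\<close>

definition orthogonal_direct_sum :: "'i set \<Rightarrow> ('i \<Rightarrow> 'a::{real_inner,banach} set) \<Rightarrow> bool" where
  "orthogonal_direct_sum I H \<longleftrightarrow>
     finite I \<and>
     (\<forall>i\<in>I. subspace (H i) \<and> closed (H i)) \<and>
     (\<forall>i\<in>I. \<forall>j\<in>I. i \<noteq> j \<longrightarrow> (\<forall>u\<in>H i. \<forall>v\<in>H j. u \<bullet> v = 0)) \<and>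
     (\<forall>x. \<exists>y\<in>Pi\<^sub>E I H. x = (\<Sum>i\<in>I. y i))"

definition component :: "'i set \<Rightarrow> ('i \<Rightarrow> 'a::{real_inner,banach} set) \<Rightarrow> 'i \<Rightarrow> 'a \<Rightarrow> 'a" where
  "component I H i x = (THE y. y \<in> Pi\<^sub>E I H \<and> x = (\<Sum>j\<in>I. y j)) i"

definition block_part :: "'i set \<Rightarrow> ('i \<Rightarrow> 'a::{real_inner,banach} set) \<Rightarrow> 'i set \<Rightarrow> 'a \<Rightarrow> 'a" where
  "block_part I H J x = (\<Sum>i\<in>J. component I H i x)"

definition block_product ::
  "'i set \<Rightarrow> ('i \<Rightarrow> 'a::{real_inner,banach} set) \<Rightarrow> ('i \<Rightarrow> 'a set) \<Rightarrow> 'i set \<Rightarrow> 'a set" where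
  "block_product I H C J =
     {x. (\<forall>i\<in>J. component I H i x \<in> C i) \<and> (\<forall>i\<in>I - J. component I H i x = 0)}"

text \<open>
  On a Hilbert space a gradient exists at every point of Frechet differentiability, by the
  Riesz representation theorem, and it is unique.
\<close>

definition gradient :: "('a::{real_inner,banach} \<Rightarrow> real) \<Rightarrow> 'a \<Rightarrow> 'a" where
  "gradient f x = (THE g. GDERIV f x :> g)"

definition linear_minimization_oracle ::
  "'i set \<Rightarrow> ('i \<Rightarrow> 'a::{real_inner,banach} set) \<Rightarrow> ('i \<Rightarrow> 'a set) \<Rightarrow> ('i set \<Rightarrow> 'a \<Rightarrow> 'a) \<Rightarrow> bool"
where
  "linear_minimization_oracle I H C LMO \<longleftrightarrow>
     (\<forall>J\<subseteq>I. \<forall>c. is_arg_min (\<lambda>v. block_part I H J c \<bullet> v) (\<lambda>v. v \<in> block_product I H C J) (LMO J c))"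

definition frank_wolfe_gap ::
  "'i set \<Rightarrow> ('i \<Rightarrow> 'a::{real_inner,banach} set) \<Rightarrow> ('a \<Rightarrow> real) \<Rightarrow> ('i set \<Rightarrow> 'a \<Rightarrow> 'a)
     \<Rightarrow> 'i set \<Rightarrow> 'a \<Rightarrow> real" where
  "frank_wolfe_gap I H f LMO J x =
     block_part I H J (gradient f x) \<bullet>
       (block_part I H J x - LMO J (block_part I H J (gradient f x)))"

text \<open>
  The gap over the whole index set, in its form without LMO; the lemma
  \<open>frank_wolfe_gap_eq_SUP\<close> below shows that the two forms agree.
\<close>

definition stationary_point :: "('a::{real_inner,banach} \<Rightarrow> real) \<Rightarrow> 'a set \<Rightarrow> 'a \<Rightarrow> bool" where
  "stationary_point f C x \<longleftrightarrow> x \<in> C \<and> (SUP v\<in>C. gradient f x \<bullet> (x - v)) \<le> 0"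

text \<open>
  If the \<open>i\<close>-th component of the iterate \<open>x\<close> already is the minimizer \<open>v\<close>, the quotient in
  the step size is \<open>0 / 0 = 0\<close>, and the step leaves the component unchanged.
\<close>

definition short_step_update ::
  "'i set \<Rightarrow> ('i \<Rightarrow> 'a::{real_inner,banach} set) \<Rightarrow> ('a \<Rightarrow> real) \<Rightarrow> real \<Rightarrow> ('i set \<Rightarrow> 'a \<Rightarrow> 'a)
     \<Rightarrow> 'i \<Rightarrow> 'a \<Rightarrow> 'a" where
  "short_step_update I H f L LMO i x =
     (let g = component I H i (gradient f x);
          v = LMO {i} g;
          u = component I H i x;
          \<gamma> = min 1 ((g \<bullet> (u - v)) / (L * (norm (v - u))\<^sup>2))
      in u + \<gamma> *\<^sub>R (v - u))"

definition short_step_bcfw ::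
  "'i set \<Rightarrow> ('i \<Rightarrow> 'a::{real_inner,banach} set) \<Rightarrow> ('i \<Rightarrow> 'a set) \<Rightarrow> ('a \<Rightarrow> real) \<Rightarrow> real
     \<Rightarrow> ('i set \<Rightarrow> 'a \<Rightarrow> 'a) \<Rightarrow> (nat \<Rightarrow> 'i set) \<Rightarrow> (nat \<Rightarrow> 'a) \<Rightarrow> bool" where
  "short_step_bcfw I H C f L LMO B x \<longleftrightarrow>
     x 0 \<in> block_product I H C I \<and>
     (\<forall>t. B t \<noteq> {} \<and> B t \<subseteq> I \<and>
       (\<forall>i\<in>B t. component I H i (x (Suc t)) = short_step_update I H f L LMO i (x t)) \<and>
       (\<forall>i\<in>I - B t. component I H i (x (Suc t)) = component I H i (x t)))"

text \<open>
  The quantity \<open>A\<^sub>n\<close>: the gaps over those blocks updated at step \<open>n + k - 1\<close> that are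
  updated again within the window \<open>n, \<dots>, n + K - 1\<close>.
\<close>

definition repeated_gaps ::
  "'i set \<Rightarrow> ('i \<Rightarrow> 'a::{real_inner,banach} set) \<Rightarrow> ('a \<Rightarrow> real) \<Rightarrow> ('i set \<Rightarrow> 'a \<Rightarrow> 'a)
     \<Rightarrow> (nat \<Rightarrow> 'i set) \<Rightarrow> (nat \<Rightarrow> 'a) \<Rightarrow> nat \<Rightarrow> nat \<Rightarrow> real" where
  "repeated_gaps I H f LMO B x K n =
     (\<Sum>k=1..K-1. frank_wolfe_gap I H f LMO (B (n+k-1) \<inter> (\<Union>l\<in>{n+k..n+K-1}. B l)) (x (n+k)))"

definition accumulation_point :: "(nat \<Rightarrow> 'a::metric_space) \<Rightarrow> 'a \<Rightarrow> bool" where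
  "accumulation_point u z \<longleftrightarrow> (\<exists>s. strict_mono s \<and> (u \<circ> s) \<longlonglongrightarrow> z)"

lemma orthogonal_family_unique:
  assumes "orthogonal_direct_sum I H" "y \<in> Pi\<^sub>E I H" "z \<in> Pi\<^sub>E I H"
    and eq: "(\<Sum>i\<in>I. y i) = (\<Sum>i\<in>I. z i)"
  shows "y = z"
proof (rule PiE_ext[OF assms(2,3)])
  fix i assume i: "i \<in> I"
  have fin: "finite I" and sub: "\<And>j. j \<in> I \<Longrightarrow> subspace (H j)"
    and orth: "\<And>j u v. j \<in> I \<Longrightarrow> i \<noteq> j \<Longrightarrow> u \<in> H i \<Longrightarrow> v \<in> H j \<Longrightarrow> u \<bullet> v = 0"
    using assms(1) i unfolding orthogonal_direct_sum_def by blast+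
  define d where "d j = y j - z j" for j
  have d: "d j \<in> H j" if "j \<in> I" for j
    unfolding d_def using assms(2,3) sub that by (intro subspace_diff) auto
  have "(\<Sum>j\<in>I. d j) = 0"
    using eq by (simp add: d_def sum_subtractf)
  then have "0 = d i \<bullet> (\<Sum>j\<in>I. d j)"
    by simp
  also have "\<dots> = (\<Sum>j\<in>I. d i \<bullet> d j)"
    by (rule inner_sum_right)
  also have "\<dots> = (\<Sum>j\<in>I. if j = i then d i \<bullet> d i else 0)"
    by (intro sum.cong refl) (use d i orth in auto)
  also have "\<dots> = d i \<bullet> d i"
    using fin i by simp
  finally show "y i = z i"
    by (simp add: d_def)
qed

lemma block_part_whole:
  assumes "orthogonal_direct_sum I H"
  shows "block_part I H I x = x"
proof -
  have "\<exists>!y. y \<in> Pi\<^sub>E I H \<and> x = (\<Sum>j\<in>I. y j)"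
  proof (rule ex_ex1I)
    show "\<exists>y. y \<in> Pi\<^sub>E I H \<and> x = (\<Sum>j\<in>I. y j)"
      using assms unfolding orthogonal_direct_sum_def by blast
    show "y = z" if "y \<in> Pi\<^sub>E I H \<and> x = (\<Sum>j\<in>I. y j)" "z \<in> Pi\<^sub>E I H \<and> x = (\<Sum>j\<in>I. z j)" for y z
      using orthogonal_family_unique[OF assms, of y z] that by simp
  qed
  from theI'[OF this] show ?thesis
    unfolding block_part_def component_def by simp
qed

lemma frank_wolfe_gap_eq_SUP:
  assumes "orthogonal_direct_sum I H" "linear_minimization_oracle I H C LMO"
  shows "frank_wolfe_gap I H f LMO I x =
    (SUP v\<in>block_product I H C I. gradient f x \<bullet> (x - v))"
proof -
  define g v where "g = gradient f x" and "v = LMO I g"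
  have v: "v \<in> block_product I H C I" "\<And>w. w \<in> block_product I H C I \<Longrightarrow> g \<bullet> v \<le> g \<bullet> w"
    using assms(2) unfolding linear_minimization_oracle_def is_arg_min_def v_def
    by (auto simp: block_part_whole[OF assms(1)] not_less)
  have "(SUP w\<in>block_product I H C I. g \<bullet> (x - w)) = g \<bullet> (x - v)"
    by (rule cSup_eq_maximum) (use v in \<open>auto simp: inner_diff_right\<close>)
  then show ?thesis
    unfolding frank_wolfe_gap_def block_part_whole[OF assms(1)] g_def v_def by simp
qed

end

theory Submission
  imports Defs
begin

text \<open>
  Everything follows from one inequality, valid for every \<open>\<mu> \<ge> 1\<close> and every window of \<open>K\<close> steps:
  \<open>G (x n) + A n \<le> \<mu> * (f (x n) - f (x (n + K))) + K * L * D\<^sup>2 / \<mu>\<close>.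
  Summed over the consecutive windows that start at \<open>0\<close>, \<open>K\<close>, \<open>2 * K\<close>, and so on, the decreases
  telescope to at most \<open>H\<^sub>0\<close>. The first rate is the choice \<open>\<mu> = 2\<close>, the second one is the
  optimal \<open>\<mu> = D * sqrt (n * K * L / H\<^sub>0)\<close>. Letting \<open>n\<close> grow with \<open>\<mu>\<close> fixed but large shows that
  the gaps come arbitrarily close to \<open>0\<close> infinitely often; continuity of the gradient on \<open>C\<close> then
  makes the accumulation points stationary (\<open>stationary_limit\<close>).

  To obtain the inequality, the full gap is split into the gaps of single blocks
  (\<open>frank_wolfe_gap_eq_sum\<close>), and each block is followed from the start of the window to
  its first update, and from one update to the next. Until a block is updated, only its gradient
  changes, and a step of length \<open>s\<close> lowers the gaps of the waiting blocks by at most \<open>L * s * w\<close>,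
  where \<open>w\<close> is the distance to their minimizing vertices. The descent lemma
  (\<open>lipschitz_gradient_descent\<close>) bounds the gaps of the updated blocks by the decrease of \<open>f\<close>, and
  the short step leaves enough slack there (\<open>short_step_gap_le\<close>) to absorb the share
  \<open>\<mu> * L * s\<^sup>2 / 4\<close> of \<open>L * s * w\<close>. The other share \<open>L * w\<^sup>2 / \<mu>\<close> is harmless because waiting and
  updated blocks are orthogonal: their squared distances to the vertices add up to at most \<open>D\<^sup>2\<close>, so
  that one step costs \<open>L * D\<^sup>2 / \<mu>\<close> in total (\<open>step_bound\<close>, \<open>window_bound\<close>).
\<close>

section \<open>Gradients in a Hilbert space\<close>

text \<open>
  Riesz representation. The quadratic \<open>J v = (norm v)\<^sup>2 - 2 * \<phi> v\<close> is bounded below, the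
  parallelogram law makes every minimizing sequence Cauchy, and the first-order condition at the
  minimizer \<open>g\<close> reads \<open>\<phi> v = g \<bullet> v\<close>.
\<close>

lemma riesz_representation:
  fixes \<phi> :: "'a::{real_inner,banach} \<Rightarrow> real"
  assumes "bounded_linear \<phi>"
  shows "\<exists>g. \<forall>v. \<phi> v = g \<bullet> v"
proof -
  interpret \<phi>: bounded_linear \<phi> by (rule assms)
  obtain M where M: "\<And>v. norm (\<phi> v) \<le> norm v * M"
    using \<phi>.bounded by blast
  define J where "J v = (norm v)\<^sup>2 - 2 * \<phi> v" for v
  have low: "- M\<^sup>2 \<le> J v" for v
  proof -
    have "\<phi> v \<le> norm v * M" using M[of v] by simp
    moreover have "0 \<le> (norm v - M)\<^sup>2" by simp
    ultimately show ?thesis by (simp add: J_def power2_eq_square algebra_simps)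
  qed
  define c where "c = Inf (range J)"
  have bdd: "bdd_below (range J)"
    by (rule bdd_belowI[where m = "- M\<^sup>2"]) (use low in auto)
  have c: "c \<le> J v" for v
    unfolding c_def by (rule cInf_lower[OF _ bdd]) simp
  have "\<exists>v. J v < c + 1 / real (Suc n)" for n
    using cInf_lessD[of "range J" "c + 1 / real (Suc n)"] by (auto simp: c_def)
  then obtain u where u: "\<And>n. J (u n) < c + 1 / real (Suc n)"
    by metis
  have mid: "(norm (v - w))\<^sup>2 \<le> 2 * (J v - c) + 2 * (J w - c)" for v w
  proof -
    have "(norm (v - w))\<^sup>2 = 2 * J v + 2 * J w - 4 * J ((1/2) *\<^sub>R (v + w))"
      unfolding J_def power2_norm_eq_inner
      by (simp add: \<phi>.add \<phi>.scaleR inner_diff_left inner_diff_right inner_add_left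
          inner_add_right inner_commute algebra_simps)
    with c[of "(1/2) *\<^sub>R (v + w)"] show ?thesis by simp
  qed
  have "Cauchy u"
  proof (rule CauchyI)
    fix e :: real assume "0 < e"
    obtain N :: nat where N: "4 / e\<^sup>2 < real N"
      using reals_Archimedean2 by blast
    have "0 < 4 / e\<^sup>2" using \<open>0 < e\<close> by simp
    then have Npos: "0 < real N" using N by linarith
    have "norm (u k - u l) < e" if "N \<le> k" "N \<le> l" for k l
    proof -
      have "1 / real (Suc k) \<le> 1 / real N" "1 / real (Suc l) \<le> 1 / real N"
        using that Npos by (auto simp: frac_le)
      then have "J (u k) < c + 1 / real N" "J (u l) < c + 1 / real N"
        using u[of k] u[of l] by linarith+
      then have "2 * (J (u k) - c) + 2 * (J (u l) - c) < 4 / real N"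
        by (simp add: field_simps)
      then have "(norm (u k - u l))\<^sup>2 < 4 / real N"
        by (rule order.strict_trans1[OF mid])
      also have "\<dots> < e\<^sup>2"
        using N Npos \<open>0 < e\<close> by (simp add: field_simps)
      finally show ?thesis
        using \<open>0 < e\<close> power2_less_imp_less by fastforce
    qed
    then show "\<exists>N. \<forall>k\<ge>N. \<forall>l\<ge>N. norm (u k - u l) < e" by blast
  qed
  then obtain g where g: "u \<longlonglongrightarrow> g"
    using Cauchy_convergent convergent_def by blast
  have "(\<lambda>n. J (u n)) \<longlonglongrightarrow> J g"
    unfolding J_def by (intro tendsto_intros \<phi>.tendsto g)
  moreover have "(\<lambda>n. c + 1 / real (Suc n)) \<longlonglongrightarrow> c + 0"
    by (intro tendsto_intros LIMSEQ_Suc lim_1_over_n)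
  ultimately have "J g \<le> c + 0"
    by (rule LIMSEQ_le) (use u less_imp_le in blast)
  then have g_min: "J g \<le> J v" for v
    using c[of v] by linarith
  have "\<phi> v = g \<bullet> v" for v
  proof (cases "v = 0")
    case False
    define N q t where "N = v \<bullet> v" and "q = g \<bullet> v - \<phi> v" and "t = - q / N"
    have N: "N > 0" using False by (simp add: N_def)
    have "J (g + t *\<^sub>R v) = J g + 2 * t * q + t\<^sup>2 * N"
      unfolding J_def power2_norm_eq_inner N_def q_def
      by (simp add: \<phi>.add \<phi>.scaleR inner_add_left inner_add_right inner_commute
          power2_eq_square algebra_simps)
    then have "0 \<le> 2 * t * q + t\<^sup>2 * N"
      using g_min[of "g + t *\<^sub>R v"] by linarith
    also have "\<dots> = - (q\<^sup>2 / N)"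
      using N by (simp add: t_def field_simps power2_eq_square)
    finally have "q\<^sup>2 / N \<le> 0" by simp
    then have "q\<^sup>2 \<le> 0" using N by (simp add: divide_le_0_iff)
    then show ?thesis by (simp add: q_def)
  qed simp
  then show ?thesis by blast
qed

lemma GDERIV_gradient:
  assumes "f differentiable (at z)"
  shows "GDERIV f z :> gradient f z"
proof -
  obtain f' where f': "(f has_derivative f') (at z)"
    using assms differentiable_def by blast
  obtain g where "\<And>v. f' v = g \<bullet> v"
    using riesz_representation[OF has_derivative_bounded_linear[OF f']] by blast
  then have "f' = (\<lambda>v. v \<bullet> g)" by (auto simp: inner_commute)
  with f' have g: "GDERIV f z :> g" by (simp add: gderiv_def)
  have "g' = g" if "GDERIV f z :> g'" for g'
  proof -
    have "(\<lambda>v. v \<bullet> g') = (\<lambda>v. v \<bullet> g)"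
      using that g has_derivative_unique unfolding gderiv_def by blast
    then have "\<forall>v. v \<bullet> g' = v \<bullet> g" by (simp add: fun_eq_iff)
    then show ?thesis by (simp only: vector_eq_ldot)
  qed
  with g show ?thesis
    unfolding gradient_def by (rule theI)
qed

text \<open>
  Descent lemma: along the segment, \<open>f\<close> minus its quadratic upper model has the derivative
  \<open>(\<nabla>f(y + t d) - \<nabla>f(y)) \<bullet> d - L * t * (norm d)\<^sup>2\<close>, which is nonpositive. The segment has to
  stay in \<open>S\<close>, since nothing is known about the gradient elsewhere.
\<close>

lemma lipschitz_gradient_descent:
  assumes diff: "\<And>z. f differentiable (at z)"
    and lip: "L-lipschitz_on S (gradient f)" and "convex S" "y \<in> S" "z \<in> S"
  shows "f z \<le> f y + gradient f y \<bullet> (z - y) + L / 2 * (norm (z - y))\<^sup>2"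
proof -
  define d where "d = z - y"
  define h where "h t = f (y + t *\<^sub>R d) - t * (gradient f y \<bullet> d) - L / 2 * t\<^sup>2 * (norm d)\<^sup>2" for t
  have "h 1 \<le> h 0"
  proof (rule DERIV_nonpos_imp_nonincreasing[of 0 1 h])
    fix t :: real assume t: "0 \<le> t" "t \<le> 1"
    let ?p = "y + t *\<^sub>R d"
    have p: "?p \<in> S"
    proof -
      have "?p = (1 - t) *\<^sub>R y + t *\<^sub>R z" by (simp add: d_def algebra_simps)
      then show ?thesis using convexD_alt[of S y z t] assms t by simp
    qed
    have "((\<lambda>t. f (y + t *\<^sub>R d)) has_derivative (\<lambda>r. (r *\<^sub>R d) \<bullet> gradient f ?p)) (at t)"
    proof (rule has_derivative_compose[of "\<lambda>t. y + t *\<^sub>R d" "\<lambda>r. r *\<^sub>R d"])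
      show "((\<lambda>t. y + t *\<^sub>R d) has_derivative (\<lambda>r. r *\<^sub>R d)) (at t)"
        by (auto intro!: derivative_eq_intros)
      show "(f has_derivative (\<lambda>r. r \<bullet> gradient f ?p)) (at ?p)"
        using GDERIV_gradient[OF diff] unfolding gderiv_def .
    qed
    then have "((\<lambda>t. f (y + t *\<^sub>R d)) has_real_derivative (gradient f ?p \<bullet> d)) (at t)"
      by (simp add: has_field_derivative_def inner_commute mult.commute[of _ "_ \<bullet> _"])
    then have "(h has_real_derivative
        (gradient f ?p \<bullet> d - gradient f y \<bullet> d - L * t * (norm d)\<^sup>2)) (at t)"
      unfolding h_def by (auto intro!: derivative_eq_intros)
    moreover have "gradient f ?p \<bullet> d - gradient f y \<bullet> d \<le> L * t * (norm d)\<^sup>2"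
    proof -
      have "gradient f ?p \<bullet> d - gradient f y \<bullet> d \<le> norm (gradient f ?p - gradient f y) * norm d"
        using norm_cauchy_schwarz by (simp add: inner_diff_left[symmetric])
      also have "\<dots> \<le> (L * dist ?p y) * norm d"
        using lipschitz_onD[OF lip p \<open>y \<in> S\<close>] by (intro mult_right_mono) (auto simp: dist_norm)
      also have "\<dots> = L * t * (norm d)\<^sup>2"
        using t by (simp add: dist_norm power2_eq_square)
      finally show ?thesis .
    qed
    ultimately show "\<exists>r. (h has_real_derivative r) (at t) \<and> r \<le> 0" by force
  qed simp
  then show ?thesis by (simp add: h_def d_def)
qed

section \<open>Scalar estimates\<close>

text \<open>
  The estimate behind both rates. With the short step \<open>\<gamma>\<close>, the quantity \<open>\<gamma> * G - L * \<gamma>\<^sup>2 * q / 2\<close>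
  is the guaranteed decrease of the objective on one block; a further quarter of
  \<open>\<mu> * L * \<gamma>\<^sup>2 * q\<close> is left over to pay for the change of the gradient caused by the step.
  For \<open>\<gamma> = G / (L * q)\<close> the claim is \<open>(\<mu> * \<gamma> / 2 - 1)\<^sup>2 \<ge> 0\<close> up to a positive factor. For \<open>\<gamma> = 1\<close> it
  is linear in \<open>G \<ge> L * q\<close>, and as \<open>\<mu> \<ge> 1\<close>, the worst case \<open>G = L * q\<close> is the previous one.
\<close>

lemma short_step_gap_le:
  fixes G L \<mu> q \<gamma> :: real
  assumes "L > 0" "\<mu> \<ge> 1" "0 \<le> q" "q = 0 \<Longrightarrow> G = 0"
    and \<gamma>: "\<gamma> = min 1 (G / (L * q))"
  shows "G + \<mu> * L * \<gamma>\<^sup>2 * q / 4 \<le> \<mu> * (\<gamma> * G - L * \<gamma>\<^sup>2 * q / 2) + L * q / \<mu>"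
proof (cases "q = 0")
  case True
  then show ?thesis using assms by simp
next
  case False
  then have Lq: "L * q > 0" using assms by simp
  have sq: "\<gamma> \<le> \<mu> * \<gamma>\<^sup>2 / 4 + 1 / \<mu>"
  proof -
    have "0 \<le> (\<mu> * \<gamma> / 2 - 1)\<^sup>2 / \<mu>" using assms by simp
    also have "\<dots> = \<mu> * \<gamma>\<^sup>2 / 4 - \<gamma> + 1 / \<mu>"
      using assms by (simp add: field_simps power2_eq_square)
    finally show ?thesis by simp
  qed
  from mult_left_mono[OF sq, of "L * q"] Lq
  have sqLq: "L * q * \<gamma> \<le> \<mu> * L * \<gamma>\<^sup>2 * q / 4 + L * q / \<mu>"
    by (simp add: algebra_simps)
  show ?thesis
  proof (cases "G / (L * q) \<le> 1")
    case True
    then have "G = L * q * \<gamma>" using \<gamma> Lq False assms by simp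
    then have "\<mu> * (\<gamma> * G) = \<mu> * L * \<gamma>\<^sup>2 * q"
      by (simp add: power2_eq_square)
    moreover have "\<mu> * (\<gamma> * G - L * \<gamma>\<^sup>2 * q / 2) = \<mu> * (\<gamma> * G) - \<mu> * L * \<gamma>\<^sup>2 * q / 2"
      by (simp add: algebra_simps)
    ultimately show ?thesis using sqLq \<open>G = L * q * \<gamma>\<close> by linarith
  next
    case False
    then have 1: "\<gamma> = 1" and "L * q \<le> G" using \<gamma> Lq by (auto simp: field_simps)
    then have "(\<mu> - 1) * (L * q) \<le> (\<mu> - 1) * G"
      using assms by (intro mult_left_mono) auto
    with sqLq show ?thesis unfolding 1 by (simp add: algebra_simps)
  qed
qed

lemma mult_le_weighted_squares:
  fixes a b \<mu> :: real
  assumes "\<mu> > 0"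
  shows "a * b \<le> \<mu> * a\<^sup>2 / 4 + b\<^sup>2 / \<mu>"
proof -
  have "0 \<le> (\<mu> * a / 2 - b)\<^sup>2 / \<mu>" using assms by simp
  also have "\<dots> = \<mu> * a\<^sup>2 / 4 - a * b + b\<^sup>2 / \<mu>"
    using assms by (simp add: field_simps power2_eq_square)
  finally show ?thesis by simp
qed

text \<open>
  The family of bounds \<open>\<mu> * h + c / \<mu>\<close> is minimized by \<open>\<mu> = sqrt (c / h)\<close>, with the value
  \<open>2 * sqrt (h * c)\<close>; for \<open>h = 0\<close> the infimum is only approached as \<open>\<mu>\<close> grows.
\<close>

lemma le_two_sqrt_of_le_weighted:
  fixes S h c :: real
  assumes bound: "\<And>\<mu>. \<mu> \<ge> 1 \<Longrightarrow> S \<le> \<mu> * h + c / \<mu>"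
    and "0 \<le> h" "h \<le> c"
  shows "S \<le> 2 * sqrt (h * c)"
proof (cases "h = 0")
  case True
  have "S \<le> 0"
  proof (rule ccontr)
    assume "\<not> S \<le> 0"
    then have S: "S > 0" by simp
    define \<mu> where "\<mu> = max 1 (2 * c / S)"
    have "2 * c / S \<le> \<mu>" "\<mu> \<ge> 1" by (auto simp: \<mu>_def)
    then have "c / \<mu> \<le> S / 2" using S by (simp add: field_simps)
    with bound[OF \<open>\<mu> \<ge> 1\<close>] True S show False by simp
  qed
  with True show ?thesis by simp
next
  case False
  then have h: "h > 0" and c: "c > 0" using assms by auto
  define \<mu> where "\<mu> = sqrt (c / h)"
  have "\<mu> \<ge> 1" using h assms by (simp add: \<mu>_def)
  have "\<mu> * h = sqrt (h * c)" "c / \<mu> = sqrt (h * c)"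
    using h c unfolding \<mu>_def
    by (simp_all add: real_sqrt_divide real_sqrt_mult field_simps)
  with bound[OF \<open>\<mu> \<ge> 1\<close>] show ?thesis by simp
qed

text \<open>
  If all terms from some point on were at least \<open>e\<close>, the partial sums would grow at the rate \<open>e\<close>;
  but a fixed \<open>\<mu> \<ge> 2 * c / e\<close> bounds their rate by \<open>e / 2\<close>.
\<close>

lemma vanishing_subsequence:
  fixes a :: "nat \<Rightarrow> real"
  assumes nonneg: "\<And>p. 0 \<le> a p"
    and bound: "\<And>\<mu> n. \<mu> \<ge> 1 \<Longrightarrow> (\<Sum>p<n. a p) \<le> \<mu> * h + real n * c / \<mu>"
    and "0 \<le> c"
  shows "\<exists>r. strict_mono r \<and> (\<lambda>k. a (r k)) \<longlonglongrightarrow> 0"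
proof -
  have small: "\<exists>p>N. a p < e" if "e > 0" for e N
  proof (rule ccontr)
    assume "\<not> (\<exists>p>N. a p < e)"
    then have big: "e \<le> a p" if "p > N" for p using that by force
    define \<mu> where "\<mu> = max 1 (2 * c / e)"
    have \<mu>: "\<mu> \<ge> 1" "2 * c / e \<le> \<mu>" by (auto simp: \<mu>_def)
    then have c: "c / \<mu> \<le> e / 2" using \<open>e > 0\<close> by (simp add: field_simps)
    obtain k :: nat where k: "(\<mu> * h + real (Suc N) * e) / (e / 2) < real k"
      using reals_Archimedean2 by blast
    define n where "n = Suc N + k"
    have "real k * e = (\<Sum>p\<in>{Suc N..<n}. e)" by (simp add: n_def)
    also have "\<dots> \<le> (\<Sum>p\<in>{Suc N..<n}. a p)" by (rule sum_mono) (use big in auto)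
    also have "\<dots> \<le> (\<Sum>p<n. a p)" by (rule sum_mono2) (use nonneg in auto)
    also have "\<dots> \<le> \<mu> * h + real n * (c / \<mu>)" using bound[OF \<mu>(1), of n] by simp
    also have "\<dots> \<le> \<mu> * h + real n * (e / 2)"
      using mult_left_mono[OF c, of "real n"] by simp
    finally have "real k * e \<le> \<mu> * h + real (Suc N) * e / 2 + real k * e / 2"
      by (simp add: n_def algebra_simps add_divide_distrib)
    moreover have "\<mu> * h + real (Suc N) * e < real k * e / 2"
      using k \<open>e > 0\<close> by (simp add: field_simps)
    moreover have "0 \<le> real (Suc N) * e" using \<open>e > 0\<close> by simp
    ultimately show False by linarith
  qed
  have "\<exists>r. \<forall>k. a (r k) < 1 / real (Suc k) \<and> r k < r (Suc k)"
  proof (rule dependent_nat_choice)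
    show "\<exists>p. a p < 1 / real (Suc 0)" using small[of "1 / real (Suc 0)" 0] by auto
    show "\<exists>q. a q < 1 / real (Suc (Suc k)) \<and> p < q" for p k
      using small[of "1 / real (Suc (Suc k))" p] by auto
  qed
  then obtain r where r: "\<And>k. a (r k) < 1 / real (Suc k)" "\<And>k. r k < r (Suc k)" by blast
  have "(\<lambda>k. a (r k)) \<longlonglongrightarrow> 0"
  proof (rule tendsto_sandwich[OF always_eventually always_eventually tendsto_const])
    show "(\<lambda>k. 1 / real (Suc k)) \<longlonglongrightarrow> 0" by (intro LIMSEQ_Suc lim_1_over_n)
    show "\<forall>k. 0 \<le> a (r k)" using nonneg by simp
    show "\<forall>k. a (r k) \<le> 1 / real (Suc k)" using r(1) less_imp_le by blast
  qed
  moreover have "strict_mono r" using r(2) by (simp add: strict_mono_Suc_iff)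
  ultimately show ?thesis by blast
qed

section \<open>Orthogonal blocks\<close>

locale orthogonal_blocks =
  fixes I :: "'i set" and H :: "'i \<Rightarrow> 'a::{real_inner,banach} set"
  assumes direct_sum: "orthogonal_direct_sum I H"
begin

abbreviation P :: "'i \<Rightarrow> 'a \<Rightarrow> 'a" where "P \<equiv> component I H"

lemma finite_I [simp]: "finite I"
  using direct_sum unfolding orthogonal_direct_sum_def by blast

lemma subspace_H: "i \<in> I \<Longrightarrow> subspace (H i)"
  using direct_sum unfolding orthogonal_direct_sum_def by blast

lemma orthogonal_H: "\<lbrakk>i \<in> I; j \<in> I; i \<noteq> j; u \<in> H i; v \<in> H j\<rbrakk> \<Longrightarrow> u \<bullet> v = 0"
  using direct_sum unfolding orthogonal_direct_sum_def by blast

lemma component_sum: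
  assumes "\<And>i. i \<in> I \<Longrightarrow> y i \<in> H i" "i \<in> I"
  shows "P i (\<Sum>j\<in>I. y j) = y i"
proof -
  have "(THE z. z \<in> Pi\<^sub>E I H \<and> (\<Sum>j\<in>I. y j) = (\<Sum>j\<in>I. z j)) = restrict y I"
  proof (rule the_equality)
    have "(\<Sum>j\<in>I. y j) = (\<Sum>j\<in>I. restrict y I j)" by (rule sum.cong) auto
    then show "restrict y I \<in> Pi\<^sub>E I H \<and> (\<Sum>j\<in>I. y j) = (\<Sum>j\<in>I. restrict y I j)"
      using assms(1) by auto
    then show "z = restrict y I" if "z \<in> Pi\<^sub>E I H \<and> (\<Sum>j\<in>I. y j) = (\<Sum>j\<in>I. z j)" for z
      using orthogonal_family_unique[OF direct_sum, of z "restrict y I"] that by simp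
  qed
  then show ?thesis using assms(2) by (simp add: component_def)
qed

lemma sum_component: "(\<Sum>i\<in>I. P i x) = x"
  using block_part_whole[OF direct_sum] by (simp add: block_part_def)

lemma component_in: "i \<in> I \<Longrightarrow> P i x \<in> H i"
proof -
  assume i: "i \<in> I"
  obtain y where y: "y \<in> Pi\<^sub>E I H" "x = (\<Sum>j\<in>I. y j)"
    using direct_sum unfolding orthogonal_direct_sum_def by blast
  then have "P i x = y i" using component_sum[of y i] i by auto
  then show ?thesis using y i by auto
qed

lemma component_add: "i \<in> I \<Longrightarrow> P i (x + y) = P i x + P i y"
  using component_sum[of "\<lambda>j. P j x + P j y" i] component_in subspace_H
  by (simp add: sum.distrib sum_component subspace_add)

lemma component_diff: "i \<in> I \<Longrightarrow> P i (x - y) = P i x - P i y"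
  using component_sum[of "\<lambda>j. P j x - P j y" i] component_in subspace_H
  by (simp add: sum_subtractf sum_component subspace_diff)

lemma component_scaleR: "i \<in> I \<Longrightarrow> P i (c *\<^sub>R x) = c *\<^sub>R P i x"
  using component_sum[of "\<lambda>j. c *\<^sub>R P j x" i] component_in subspace_H
  by (simp add: scaleR_right.sum[symmetric] sum_component subspace_scale)

lemma component_partial_sum:
  assumes "J \<subseteq> I" "\<And>i. i \<in> J \<Longrightarrow> y i \<in> H i" "i \<in> I"
  shows "P i (\<Sum>j\<in>J. y j) = (if i \<in> J then y i else 0)"
proof -
  have "(\<Sum>j\<in>J. y j) = (\<Sum>j\<in>I. if j \<in> J then y j else 0)"
    using assms(1) by (simp add: sum.If_cases Int_absorb1)
  then show ?thesis
    using component_sum[of "\<lambda>j. if j \<in> J then y j else 0" i] assms subspace_H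
    by (auto simp: subspace_0)
qed

lemma component_idem: "i \<in> I \<Longrightarrow> P i (P i x) = P i x"
  using component_partial_sum[of "{i}" "\<lambda>j. P j x" i] component_in by auto

lemma inner_eq_sum_components: "x \<bullet> y = (\<Sum>i\<in>I. P i x \<bullet> P i y)"
proof -
  have "x \<bullet> y = (\<Sum>i\<in>I. P i x) \<bullet> (\<Sum>j\<in>I. P j y)"
    by (simp only: sum_component)
  also have "\<dots> = (\<Sum>i\<in>I. \<Sum>j\<in>I. P i x \<bullet> P j y)"
    by (simp only: inner_sum_left) (simp only: inner_sum_right)
  also have "\<dots> = (\<Sum>i\<in>I. \<Sum>j\<in>I. if j = i then P i x \<bullet> P i y else 0)"
    by (intro sum.cong refl) (auto simp: orthogonal_H component_in)
  finally show ?thesis by simp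
qed

lemma inner_partial_sum:
  assumes "J \<subseteq> I" "\<And>i. i \<in> J \<Longrightarrow> y i \<in> H i"
  shows "x \<bullet> (\<Sum>i\<in>J. y i) = (\<Sum>i\<in>J. P i x \<bullet> y i)"
proof -
  have "x \<bullet> (\<Sum>i\<in>J. y i) = (\<Sum>i\<in>I. if i \<in> J then P i x \<bullet> y i else 0)"
    unfolding inner_eq_sum_components[of x]
    by (intro sum.cong refl) (use component_partial_sum assms in auto)
  also have "\<dots> = (\<Sum>i\<in>J. P i x \<bullet> y i)"
    using assms(1) by (simp add: sum.If_cases Int_absorb1)
  finally show ?thesis .
qed

lemma norm_partial_sum:
  assumes "J \<subseteq> I" "\<And>i. i \<in> J \<Longrightarrow> y i \<in> H i"
  shows "(norm (\<Sum>i\<in>J. y i))\<^sup>2 = (\<Sum>i\<in>J. (norm (y i))\<^sup>2)"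
proof -
  have "(norm (\<Sum>i\<in>J. y i))\<^sup>2 = (\<Sum>i\<in>J. P i (\<Sum>j\<in>J. y j) \<bullet> y i)"
    unfolding power2_norm_eq_inner by (rule inner_partial_sum[OF assms])
  also have "\<dots> = (\<Sum>i\<in>J. (norm (y i))\<^sup>2)"
    by (rule sum.cong)
      (use component_partial_sum[OF assms] assms(1) in \<open>auto simp: power2_norm_eq_inner\<close>)
  finally show ?thesis .
qed

lemma component_block_part:
  "\<lbrakk>J \<subseteq> I; i \<in> I\<rbrakk> \<Longrightarrow> P i (block_part I H J x) = (if i \<in> J then P i x else 0)"
  unfolding block_part_def by (rule component_partial_sum) (auto intro: component_in)

end

section \<open>Products of compact convex sets and the gaps of their blocks\<close>

locale block_feasible = orthogonal_blocks I H
  for I :: "'i set" and H :: "'i \<Rightarrow> 'a::{real_inner,banach} set" +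
  fixes C :: "'i \<Rightarrow> 'a set"
  assumes sets: "\<And>i. i \<in> I \<Longrightarrow> C i \<subseteq> H i \<and> C i \<noteq> {} \<and> compact (C i) \<and> convex (C i)"
begin

abbreviation X :: "'a set" where "X \<equiv> block_product I H C I"

lemma X_iff: "x \<in> X \<longleftrightarrow> (\<forall>i\<in>I. P i x \<in> C i)"
  by (simp add: block_product_def)

lemma sum_in_block_product:
  assumes "J \<subseteq> I" "\<And>i. i \<in> J \<Longrightarrow> y i \<in> C i"
  shows "(\<Sum>i\<in>J. y i) \<in> block_product I H C J"
proof -
  have "y i \<in> H i" if "i \<in> J" for i using assms sets that by blast
  then show ?thesis
    using component_partial_sum[of J y] assms by (auto simp: block_product_def)
qed

lemma convex_X: "convex X"
proof (rule convexI)
  fix x y and u v :: real assume xy: "x \<in> X" "y \<in> X" "0 \<le> u" "0 \<le> v" "u + v = 1"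
  have "P i (u *\<^sub>R x + v *\<^sub>R y) \<in> C i" if "i \<in> I" for i
    using that xy sets[of i] by (auto simp: component_add component_scaleR X_iff intro: convexD)
  then show "u *\<^sub>R x + v *\<^sub>R y \<in> X" by (simp add: X_iff)
qed

lemma compact_X: "compact X"
proof -
  have "compact {\<Sum>i\<in>J. y i |y. \<forall>i\<in>J. y i \<in> C i}" if "J \<subseteq> I" for J
    using finite_subset[OF that finite_I] that
  proof (induction J)
    case (insert j J)
    have "{\<Sum>i\<in>insert j J. y i |y. \<forall>i\<in>insert j J. y i \<in> C i}
        = {a + b |a b. a \<in> C j \<and> b \<in> {\<Sum>i\<in>J. y i |y. \<forall>i\<in>J. y i \<in> C i}}"
      (is "?A = ?B")
    proof (intro set_eqI iffI)
      fix z assume "z \<in> ?A"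
      then show "z \<in> ?B" using insert.hyps by auto
    next
      fix z assume "z \<in> ?B"
      then obtain a y where ay: "z = a + (\<Sum>i\<in>J. y i)" "a \<in> C j" "\<forall>i\<in>J. y i \<in> C i"
        by blast
      have "(\<Sum>i\<in>J. (y(j := a)) i) = (\<Sum>i\<in>J. y i)"
        using insert.hyps by (intro sum.cong) auto
      then have "z = (\<Sum>i\<in>insert j J. (y(j := a)) i)"
        using insert.hyps ay by simp
      moreover have "\<forall>i\<in>insert j J. (y(j := a)) i \<in> C i" using ay by auto
      ultimately show "z \<in> ?A" by blast
    qed
    moreover have "compact (C j)" "compact {\<Sum>i\<in>J. y i |y. \<forall>i\<in>J. y i \<in> C i}"
      using insert sets by auto
    ultimately show ?case by (simp only: compact_sums)
  qed simp
  moreover have "X = {\<Sum>i\<in>I. y i |y. \<forall>i\<in>I. y i \<in> C i}"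
  proof (intro set_eqI iffI)
    fix z assume "z \<in> X"
    then show "z \<in> {\<Sum>i\<in>I. y i |y. \<forall>i\<in>I. y i \<in> C i}"
      using sum_component[of z] by (intro CollectI exI[of _ "\<lambda>i. P i z"]) (auto simp: X_iff)
  qed (use sum_in_block_product in auto)
  ultimately show ?thesis by auto
qed

end

locale block_oracle = block_feasible I H C
  for I :: "'i set" and H :: "'i \<Rightarrow> 'a::{real_inner,banach} set" and C :: "'i \<Rightarrow> 'a set" +
  fixes LMO :: "'i set \<Rightarrow> 'a \<Rightarrow> 'a"
  assumes minimizing: "linear_minimization_oracle I H C LMO"
begin

definition vertex :: "'i \<Rightarrow> 'a \<Rightarrow> 'a" where
  "vertex i c = LMO {i} (P i c)"

definition gap :: "'i \<Rightarrow> 'a \<Rightarrow> 'a \<Rightarrow> real" where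
  "gap i c x = P i c \<bullet> (P i x - vertex i c)"

lemma LMO_in: "J \<subseteq> I \<Longrightarrow> LMO J c \<in> block_product I H C J"
  and LMO_le: "\<lbrakk>J \<subseteq> I; w \<in> block_product I H C J\<rbrakk>
    \<Longrightarrow> block_part I H J c \<bullet> LMO J c \<le> block_part I H J c \<bullet> w"
  using minimizing unfolding linear_minimization_oracle_def is_arg_min_def by (force simp: not_less)+

lemma in_singleton_product: "\<lbrakk>i \<in> I; w \<in> C i\<rbrakk> \<Longrightarrow> w \<in> block_product I H C {i}"
  using sum_in_block_product[of "{i}" "\<lambda>_. w"] by simp

lemma vertex_in:
  assumes i: "i \<in> I"
  shows "vertex i c \<in> C i"
proof -
  have v: "vertex i c \<in> block_product I H C {i}"
    unfolding vertex_def by (rule LMO_in) (use i in auto)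
  have "vertex i c = (\<Sum>j\<in>I. P j (vertex i c))" by (rule sum_component[symmetric])
  also have "\<dots> = (\<Sum>j\<in>{i}. P j (vertex i c))"
    by (rule sum.mono_neutral_right) (use v i in \<open>auto simp: block_product_def\<close>)
  finally have "vertex i c = P i (vertex i c)" by simp
  with v show ?thesis by (simp add: block_product_def)
qed

lemma vertex_in_H: "i \<in> I \<Longrightarrow> vertex i c \<in> H i"
  using vertex_in sets by blast

lemma vertex_le: "\<lbrakk>i \<in> I; w \<in> C i\<rbrakk> \<Longrightarrow> P i c \<bullet> vertex i c \<le> P i c \<bullet> w"
  using LMO_le[of "{i}" w "P i c"] in_singleton_product
  by (simp add: vertex_def block_part_def component_idem)

lemma gap_nonneg: "\<lbrakk>i \<in> I; x \<in> X\<rbrakk> \<Longrightarrow> 0 \<le> gap i c x"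
  using vertex_le[of i "P i x" c] by (simp add: gap_def inner_diff_right X_iff)

text \<open>
  A linear function on a product is minimized blockwise, so the gap of a set of blocks splits into
  the gaps of its members, although the oracle may return a different minimizer for the whole
  set than for its members.
\<close>

lemma frank_wolfe_gap_eq_sum:
  assumes J: "J \<subseteq> I"
  shows "frank_wolfe_gap I H f LMO J x = (\<Sum>i\<in>J. gap i (gradient f x) x)"
proof -
  define c where "c = block_part I H J (gradient f x)"
  define w where "w = LMO J c"
  have cP: "P i c = P i (gradient f x)" if "i \<in> J" for i
    using component_block_part[of J i] J that by (auto simp: c_def)
  have c_idem: "block_part I H J c = c"
    using cP by (simp add: block_part_def) (simp add: c_def block_part_def)
  have w: "w \<in> block_product I H C J" unfolding w_def by (rule LMO_in[OF J])
  have w_sum: "w = (\<Sum>i\<in>J. P i w)"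
  proof -
    have "w = (\<Sum>i\<in>I. P i w)" by (rule sum_component[symmetric])
    also have "\<dots> = (\<Sum>i\<in>J. P i w)"
      by (rule sum.mono_neutral_right) (use w J in \<open>auto simp: block_product_def\<close>)
    finally show ?thesis .
  qed
  have wc: "c \<bullet> w = (\<Sum>i\<in>J. P i c \<bullet> P i w)"
    by (subst w_sum, rule inner_partial_sum) (use J component_in in auto)
  have "c \<bullet> w \<le> c \<bullet> (\<Sum>i\<in>J. vertex i (gradient f x))"
    using LMO_le[OF J, of "\<Sum>i\<in>J. vertex i (gradient f x)" c] J
    by (auto simp: c_idem w_def intro: sum_in_block_product vertex_in)
  also have "\<dots> = (\<Sum>i\<in>J. P i c \<bullet> vertex i (gradient f x))"
    by (rule inner_partial_sum) (use J vertex_in_H in auto)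
  finally have "c \<bullet> w \<le> (\<Sum>i\<in>J. P i c \<bullet> vertex i (gradient f x))" .
  moreover have "(\<Sum>i\<in>J. P i c \<bullet> vertex i (gradient f x)) \<le> c \<bullet> w"
    unfolding wc using vertex_le w J cP by (intro sum_mono) (auto simp: block_product_def)
  ultimately have cw: "c \<bullet> w = (\<Sum>i\<in>J. P i c \<bullet> vertex i (gradient f x))" by linarith
  have "c \<bullet> block_part I H J x = (\<Sum>i\<in>J. P i c \<bullet> P i x)"
    unfolding block_part_def by (rule inner_partial_sum) (use J component_in in auto)
  then show ?thesis
    unfolding frank_wolfe_gap_def c_def[symmetric] w_def[symmetric] inner_diff_right cw
    by (simp add: gap_def cP inner_diff_right sum_subtractf)
qed

lemma frank_wolfe_gap_nonneg:
  "\<lbrakk>J \<subseteq> I; x \<in> X\<rbrakk> \<Longrightarrow> 0 \<le> frank_wolfe_gap I H f LMO J x"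
  by (auto simp: frank_wolfe_gap_eq_sum intro!: sum_nonneg gap_nonneg)

lemma inner_le_frank_wolfe_gap:
  assumes "v \<in> X"
  shows "gradient f x \<bullet> (x - v) \<le> frank_wolfe_gap I H f LMO I x"
proof -
  have "gradient f x \<bullet> (x - v) = (\<Sum>i\<in>I. P i (gradient f x) \<bullet> (P i x - P i v))"
    by (subst inner_eq_sum_components) (simp add: component_diff)
  also have "\<dots> \<le> (\<Sum>i\<in>I. gap i (gradient f x) x)"
    using assms vertex_le by (intro sum_mono) (auto simp: gap_def inner_diff_right X_iff)
  finally show ?thesis by (simp add: frank_wolfe_gap_eq_sum)
qed

text \<open>
  Orthogonality makes the squared distances to the vertices of disjoint blocks share the single
  budget \<open>(diameter X)\<^sup>2\<close>.
\<close>

lemma sum_vertex_dist_le: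
  assumes x: "x \<in> X"
  shows "(\<Sum>i\<in>I. (norm (vertex i c - P i x))\<^sup>2) \<le> (diameter X)\<^sup>2"
proof -
  define v where "v = (\<Sum>i\<in>I. vertex i c)"
  have "v \<in> X" unfolding v_def by (rule sum_in_block_product) (auto intro: vertex_in)
  then have "norm (v - x) \<le> diameter X"
    using diameter_bounded_bound[OF compact_imp_bounded[OF compact_X]] x by (simp add: dist_norm)
  then have "(norm (v - x))\<^sup>2 \<le> (diameter X)\<^sup>2" by (rule power_mono) simp
  moreover have "v - x = (\<Sum>i\<in>I. vertex i c - P i x)"
    by (simp add: v_def sum_subtractf sum_component)
  moreover have "(norm (\<Sum>i\<in>I. vertex i c - P i x))\<^sup>2 = (\<Sum>i\<in>I. (norm (vertex i c - P i x))\<^sup>2)"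
    by (rule norm_partial_sum) (auto intro: subspace_diff subspace_H vertex_in_H component_in)
  ultimately show ?thesis by simp
qed

text \<open>
  The vertex at \<open>c\<close> is a competitor for the vertex at \<open>c'\<close>, so a block that does not move
  changes its gap at most by the change of the linear function, tested on the segment to the vertex.
\<close>

lemma gap_diff_le:
  assumes "i \<in> I" "P i y = P i x"
  shows "gap i c x \<le> gap i c' y + P i (c - c') \<bullet> (P i x - vertex i c)"
proof -
  have "P i c' \<bullet> vertex i c' \<le> P i c' \<bullet> vertex i c"
    by (rule vertex_le) (use assms vertex_in in auto)
  then show ?thesis
    using assms by (simp add: gap_def component_diff inner_diff_left inner_diff_right)
qed

end

section \<open>Progress of the short steps\<close>

locale short_step_run = block_oracle I H C LMO
  for I :: "'i set" and H :: "'i \<Rightarrow> 'a::{real_inner,banach} set" and C :: "'i \<Rightarrow> 'a set"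
    and LMO :: "'i set \<Rightarrow> 'a \<Rightarrow> 'a" +
  fixes f :: "'a \<Rightarrow> real" and L :: real and B :: "nat \<Rightarrow> 'i set" and x :: "nat \<Rightarrow> 'a"
  assumes differentiable: "\<And>z. f differentiable (at z)"
    and L_pos: "L > 0"
    and smooth: "L-lipschitz_on (block_product I H C I) (gradient f)"
    and run: "short_step_bcfw I H C f L LMO B x"
begin

abbreviation "grad t \<equiv> gradient f (x t)"
abbreviation "dir i t \<equiv> vertex i (grad t) - P i (x t)"
abbreviation "gap_at i t \<equiv> gap i (grad t) (x t)"
abbreviation "gap_sum J t \<equiv> frank_wolfe_gap I H f LMO J (x t)"

definition step :: "'i \<Rightarrow> nat \<Rightarrow> real" where
  "step i t = min 1 (gap_at i t / (L * (norm (dir i t))\<^sup>2))"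

lemma B_subset: "B t \<subseteq> I"
  using run unfolding short_step_bcfw_def by blast

lemma component_updated: "i \<in> B t \<Longrightarrow> P i (x (Suc t)) = P i (x t) + step i t *\<^sub>R dir i t"
  using run unfolding short_step_bcfw_def short_step_update_def step_def gap_def vertex_def Let_def
  by simp

lemma component_kept: "i \<in> I - B t \<Longrightarrow> P i (x (Suc t)) = P i (x t)"
  using run unfolding short_step_bcfw_def by blast

lemma iterate_in: "x t \<in> X"
proof (induction t)
  case 0
  show ?case using run unfolding short_step_bcfw_def by blast
next
  case (Suc t)
  have "P i (x (Suc t)) \<in> C i" if i: "i \<in> I" for i
  proof (cases "i \<in> B t")
    case True
    have "0 \<le> step i t" "step i t \<le> 1"
      using gap_nonneg[OF i Suc] L_pos by (auto simp: step_def)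
    then have "(1 - step i t) *\<^sub>R P i (x t) + step i t *\<^sub>R vertex i (grad t) \<in> C i"
      using sets[OF i] vertex_in[OF i] Suc i by (intro convexD_alt) (auto simp: X_iff)
    also have "(1 - step i t) *\<^sub>R P i (x t) + step i t *\<^sub>R vertex i (grad t) = P i (x (Suc t))"
      unfolding component_updated[OF True] by (simp add: algebra_simps)
    finally show ?thesis .
  next
    case False
    then show ?thesis using component_kept[of i t] Suc i by (simp add: X_iff)
  qed
  then show ?case by (simp add: X_iff)
qed

lemma dir_in: "i \<in> I \<Longrightarrow> dir i t \<in> H i"
  by (intro subspace_diff subspace_H vertex_in_H component_in)

lemma update_in: "i \<in> B t \<Longrightarrow> step i t *\<^sub>R dir i t \<in> H i"
  using B_subset dir_in subspace_H by (blast intro: subspace_scale)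

lemma increment: "x (Suc t) - x t = (\<Sum>i\<in>B t. step i t *\<^sub>R dir i t)"
proof -
  have "x (Suc t) - x t = (\<Sum>i\<in>I. P i (x (Suc t)) - P i (x t))"
    by (simp add: sum_subtractf sum_component)
  also have "\<dots> = (\<Sum>i\<in>B t. P i (x (Suc t)) - P i (x t))"
    by (rule sum.mono_neutral_right) (use B_subset component_kept in auto)
  also have "\<dots> = (\<Sum>i\<in>B t. step i t *\<^sub>R dir i t)"
    by (rule sum.cong) (auto simp: component_updated)
  finally show ?thesis .
qed

lemma norm_increment: "(norm (x (Suc t) - x t))\<^sup>2 = (\<Sum>i\<in>B t. (step i t)\<^sup>2 * (norm (dir i t))\<^sup>2)"
  unfolding increment
  by (subst norm_partial_sum[OF B_subset update_in]) (simp_all add: power_mult_distrib)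

lemma decrease:
  "(\<Sum>i\<in>B t. step i t * gap_at i t - L * (step i t)\<^sup>2 * (norm (dir i t))\<^sup>2 / 2) \<le> f (x t) - f (x (Suc t))"
proof -
  have "grad t \<bullet> (x (Suc t) - x t) = (\<Sum>i\<in>B t. P i (grad t) \<bullet> (step i t *\<^sub>R dir i t))"
    unfolding increment by (rule inner_partial_sum[OF B_subset update_in])
  also have "\<dots> = - (\<Sum>i\<in>B t. step i t * gap_at i t)"
    unfolding sum_negf[symmetric]
    by (intro sum.cong refl) (simp add: gap_def inner_diff_right algebra_simps)
  finally have lin: "grad t \<bullet> (x (Suc t) - x t) = - (\<Sum>i\<in>B t. step i t * gap_at i t)" .
  have quad: "L / 2 * (norm (x (Suc t) - x t))\<^sup>2
      = (\<Sum>i\<in>B t. L * (step i t)\<^sup>2 * (norm (dir i t))\<^sup>2 / 2)"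
    unfolding norm_increment sum_distrib_left by (intro sum.cong refl) simp
  have "f (x (Suc t)) \<le> f (x t) + grad t \<bullet> (x (Suc t) - x t) + L / 2 * (norm (x (Suc t) - x t))\<^sup>2"
    by (rule lipschitz_gradient_descent[OF differentiable smooth convex_X]) (rule iterate_in)+
  then show ?thesis unfolding lin quad by (simp add: sum_subtractf)
qed

text \<open>
  One step, with a set \<open>S\<close> of blocks that are not updated at time \<open>t\<close> but whose gaps are wanted.
  The gaps in \<open>S\<close> at time \<open>t\<close> are carried over to time \<open>t + 1\<close> at the price of
  \<open>L * s * w\<close>, where \<open>s\<close> is the length of the step and \<open>w\<close> is the distance to the vertices in \<open>S\<close>. The
  splitting \<open>s * w \<le> \<mu> * s\<^sup>2 / 4 + w\<^sup>2 / \<mu>\<close> is chosen so that the first part is paid for by the slack in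
  \<open>short_step_gap_le\<close>, and the second part joins the terms \<open>L * q / \<mu>\<close> of the updated blocks:
  since \<open>S\<close> and \<open>B t\<close> are disjoint, together they stay below \<open>L * (diameter X)\<^sup>2 / \<mu>\<close>.
\<close>

lemma step_bound:
  assumes \<mu>: "\<mu> \<ge> 1" and S: "S \<subseteq> I - B t"
  shows "gap_sum (B t) t + gap_sum S t
    \<le> gap_sum S (Suc t) + \<mu> * (f (x t) - f (x (Suc t))) + L * (diameter X)\<^sup>2 / \<mu>"
proof -
  define s where "s = norm (x (Suc t) - x t)"
  define w where "w = (\<Sum>i\<in>S. P i (x t) - vertex i (grad t))"
  define q where "q i = (norm (dir i t))\<^sup>2" for i
  have SI: "S \<subseteq> I" using S by blast
  have neg_dir: "P i (x t) - vertex i (grad t) \<in> H i" if "i \<in> S" for i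
    using that SI by (intro subspace_diff subspace_H vertex_in_H component_in) auto
  have w: "(norm w)\<^sup>2 = (\<Sum>i\<in>S. q i)"
    unfolding w_def q_def
    by (subst norm_partial_sum[OF SI neg_dir]) (auto simp: norm_minus_commute)
  have "gap_sum S t \<le> (\<Sum>i\<in>S. gap_at i (Suc t)
      + P i (grad t - grad (Suc t)) \<bullet> (P i (x t) - vertex i (grad t)))"
    unfolding frank_wolfe_gap_eq_sum[OF SI]
    by (intro sum_mono gap_diff_le) (use S component_kept in auto)
  also have "\<dots> = gap_sum S (Suc t) + (grad t - grad (Suc t)) \<bullet> w"
  proof -
    have "(grad t - grad (Suc t)) \<bullet> w
        = (\<Sum>i\<in>S. P i (grad t - grad (Suc t)) \<bullet> (P i (x t) - vertex i (grad t)))"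
      unfolding w_def by (rule inner_partial_sum[OF SI neg_dir])
    then show ?thesis unfolding frank_wolfe_gap_eq_sum[OF SI] by (simp add: sum.distrib)
  qed
  also have "(grad t - grad (Suc t)) \<bullet> w \<le> norm (grad t - grad (Suc t)) * norm w"
    by (rule norm_cauchy_schwarz)
  also have "\<dots> \<le> L * s * norm w"
    using lipschitz_onD[OF smooth iterate_in iterate_in, of t "Suc t"]
    by (intro mult_right_mono) (auto simp: s_def dist_norm norm_minus_commute)
  also have "\<dots> \<le> L * (\<mu> * s\<^sup>2 / 4 + (norm w)\<^sup>2 / \<mu>)"
    using mult_left_mono[OF mult_le_weighted_squares[of \<mu> s "norm w"], of L] \<mu> L_pos
    by (simp add: mult.assoc)
  finally have gS: "gap_sum S t \<le> gap_sum S (Suc t) + \<mu> * L * s\<^sup>2 / 4 + L * (\<Sum>i\<in>S. q i) / \<mu>"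
    by (simp add: w algebra_simps)
  have "(\<Sum>i\<in>B t. gap_at i t + \<mu> * L * (step i t)\<^sup>2 * q i / 4)
      \<le> (\<Sum>i\<in>B t. \<mu> * (step i t * gap_at i t - L * (step i t)\<^sup>2 * q i / 2) + L * q i / \<mu>)"
  proof (rule sum_mono)
    fix i assume "i \<in> B t"
    have "gap_at i t = 0" if "q i = 0" using that by (simp add: q_def gap_def)
    then show "gap_at i t + \<mu> * L * (step i t)\<^sup>2 * q i / 4
        \<le> \<mu> * (step i t * gap_at i t - L * (step i t)\<^sup>2 * q i / 2) + L * q i / \<mu>"
      by (intro short_step_gap_le L_pos \<mu>) (auto simp: step_def q_def)
  qed
  moreover have "(\<Sum>i\<in>B t. gap_at i t + \<mu> * L * (step i t)\<^sup>2 * q i / 4)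
      = gap_sum (B t) t + \<mu> * L * s\<^sup>2 / 4"
    unfolding frank_wolfe_gap_eq_sum[OF B_subset] s_def norm_increment q_def
    by (simp add: sum.distrib sum_distrib_left sum_divide_distrib mult.assoc)
  moreover have "(\<Sum>i\<in>B t. \<mu> * (step i t * gap_at i t - L * (step i t)\<^sup>2 * q i / 2) + L * q i / \<mu>)
      = \<mu> * (\<Sum>i\<in>B t. step i t * gap_at i t - L * (step i t)\<^sup>2 * q i / 2) + L * (\<Sum>i\<in>B t. q i) / \<mu>"
    by (simp add: sum.distrib sum_distrib_left sum_divide_distrib)
  moreover have "\<mu> * (\<Sum>i\<in>B t. step i t * gap_at i t - L * (step i t)\<^sup>2 * q i / 2)
      \<le> \<mu> * (f (x t) - f (x (Suc t)))"
    using decrease[of t] \<mu> by (intro mult_left_mono) (auto simp: q_def)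
  ultimately have gB: "gap_sum (B t) t + \<mu> * L * s\<^sup>2 / 4
      \<le> \<mu> * (f (x t) - f (x (Suc t))) + L * (\<Sum>i\<in>B t. q i) / \<mu>" by linarith
  have fin: "finite (B t)" "finite S"
    using B_subset SI finite_I finite_subset by blast+
  have "(\<Sum>i\<in>B t. q i) + (\<Sum>i\<in>S. q i) = (\<Sum>i\<in>B t \<union> S. q i)"
    using S by (intro sum.union_disjoint[symmetric] fin) auto
  also have "\<dots> \<le> (\<Sum>i\<in>I. q i)"
    by (rule sum_mono2) (use B_subset SI in \<open>auto simp: q_def\<close>)
  also have "\<dots> \<le> (diameter X)\<^sup>2"
    unfolding q_def by (rule sum_vertex_dist_le[OF iterate_in])
  finally have "L * ((\<Sum>i\<in>B t. q i) + (\<Sum>i\<in>S. q i)) / \<mu> \<le> L * (diameter X)\<^sup>2 / \<mu>"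
    using L_pos \<mu> by (intro divide_right_mono mult_left_mono) auto
  then have "L * (\<Sum>i\<in>B t. q i) / \<mu> + L * (\<Sum>i\<in>S. q i) / \<mu> \<le> L * (diameter X)\<^sup>2 / \<mu>"
    by (simp add: algebra_simps add_divide_distrib)
  with gS gB show ?thesis by linarith
qed

text \<open>
  Let \<open>R k\<close> be the blocks that are still to be updated in the window at or after time \<open>n + k\<close>. A
  block in \<open>R k\<close> is either updated at time \<open>n + k\<close>, or it waits and lies in \<open>R (k + 1)\<close>. The other
  members of \<open>R (k + 1)\<close> have just been updated and will be updated again; their gaps are exactly
  the terms of \<open>repeated_gaps\<close>. Hence the gap over \<open>R k\<close> telescopes, from the full gap at \<open>k = 0\<close> to
  the empty gap at \<open>k = K\<close>.
\<close>

lemma window_bound: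
  assumes \<mu>: "\<mu> \<ge> 1" and K: "K > 0" and cover: "I = (\<Union>k\<in>{n..n+K-1}. B k)"
  shows "gap_sum I n + repeated_gaps I H f LMO B x K n
    \<le> \<mu> * (f (x n) - f (x (n + K))) + real K * (L * (diameter X)\<^sup>2 / \<mu>)"
proof -
  define R where "R k = (\<Union>l\<in>{n+k..<n+K}. B l)" for k
  define a where "a k = gap_sum (B (n+k) \<inter> R (Suc k)) (Suc (n + k))" for k
  define e where "e = L * (diameter X)\<^sup>2 / \<mu>"
  have RI: "R k \<subseteq> I" for k unfolding R_def using B_subset by blast
  have finR: "finite (R k)" for k using RI finite_I finite_subset by blast
  have split: "gap_sum J t + gap_sum J' t = gap_sum (J \<union> J') t"
    if "J \<subseteq> I" "J' \<subseteq> I" "J \<inter> J' = {}" for J J' t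
    using that finite_subset[OF _ finite_I]
    by (simp add: frank_wolfe_gap_eq_sum sum.union_disjoint)
  have one: "gap_sum (R k) (n + k) - gap_sum (R (Suc k)) (n + Suc k) + a k
      \<le> \<mu> * (f (x (n + k)) - f (x (n + Suc k))) + e" if "k < K" for k
  proof -
    define S where "S = R (Suc k) - B (n + k)"
    have "{n+k..<n+K} = insert (n+k) {n + Suc k..<n+K}" using that by auto
    then have "R k = B (n + k) \<union> S" by (auto simp: R_def S_def)
    then have "gap_sum (R k) (n + k) = gap_sum (B (n + k)) (n + k) + gap_sum S (n + k)"
      by (subst split) (use B_subset RI[of "Suc k"] in \<open>auto simp: S_def\<close>)
    moreover have "gap_sum (R (Suc k)) (n + Suc k) = gap_sum S (n + Suc k) + a k"
      unfolding a_def add_Suc_right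
      by (subst split) (use RI in \<open>auto simp: S_def intro!: arg_cong[of _ _ "\<lambda>J. gap_sum J _"]\<close>)
    moreover have "gap_sum (B (n + k)) (n + k) + gap_sum S (n + k)
        \<le> gap_sum S (n + Suc k) + \<mu> * (f (x (n + k)) - f (x (n + Suc k))) + e"
      using step_bound[OF \<mu>, of S "n + k"] RI by (auto simp: S_def e_def)
    ultimately show ?thesis by linarith
  qed
  have "(\<Sum>k<K. gap_sum (R k) (n + k) - gap_sum (R (Suc k)) (n + Suc k) + a k)
      \<le> (\<Sum>k<K. \<mu> * (f (x (n + k)) - f (x (n + Suc k))) + e)"
    by (rule sum_mono) (use one in simp)
  moreover have "(\<Sum>k<K. gap_sum (R k) (n + k) - gap_sum (R (Suc k)) (n + Suc k) + a k)
      = gap_sum (R 0) n - gap_sum (R K) (n + K) + (\<Sum>k<K. a k)"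
    using sum_lessThan_telescope'[of "\<lambda>k. gap_sum (R k) (n + k)" K] by (simp add: sum.distrib)
  moreover have "(\<Sum>k<K. \<mu> * (f (x (n + k)) - f (x (n + Suc k))) + e)
      = \<mu> * (f (x n) - f (x (n + K))) + real K * e"
    using sum_lessThan_telescope'[of "\<lambda>k. f (x (n + k))" K]
    by (simp add: sum.distrib sum_distrib_left[symmetric])
  moreover have "R 0 = I"
    using K unfolding R_def cover by (intro arg_cong[of _ _ "\<lambda>T. \<Union>l\<in>T. B l"]) auto
  moreover have "gap_sum (R K) (n + K) = 0"
    by (simp add: R_def frank_wolfe_gap_eq_sum)
  moreover have "(\<Sum>k<K. a k) = repeated_gaps I H f LMO B x K n"
  proof -
    obtain K' where K': "K = Suc K'" using K gr0_implies_Suc by blast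
    have last: "a K' = 0"
      by (simp add: a_def R_def K' frank_wolfe_gap_eq_sum)
    have "(\<Sum>k<K. a k) = (\<Sum>k<K'. a k)" using last by (simp add: K')
    also have "\<dots> = (\<Sum>k=1..K'. a (k - 1))"
      by (rule sum.reindex_bij_witness[of _ "\<lambda>k. k - 1" Suc]) auto
    also have "\<dots> = repeated_gaps I H f LMO B x K n"
      unfolding repeated_gaps_def
    proof (rule sum.cong)
      fix k assume k: "k \<in> {1..K - 1}"
      then have "{n + Suc (k - 1)..<n + K} = {n + k..n + K - 1}" "n + (k - 1) = n + k - 1"
          "Suc (n + (k - 1)) = n + k"
        using K by auto
      then show "a (k - 1)
          = gap_sum (B (n + k - 1) \<inter> (\<Union>l\<in>{n+k..n+K-1}. B l)) (n + k)"
        unfolding a_def R_def by (simp only:)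
    qed (simp add: K')
    finally show ?thesis .
  qed
  ultimately show ?thesis by (simp add: e_def)
qed

lemma repeated_gaps_nonneg: "0 \<le> repeated_gaps I H f LMO B x K n"
  unfolding repeated_gaps_def
  by (intro sum_nonneg frank_wolfe_gap_nonneg iterate_in) (use B_subset in blast)

lemma INF_le: "z \<in> X \<Longrightarrow> (INF y\<in>X. f y) \<le> f z"
proof -
  have "continuous_on X f"
    using differentiable differentiable_imp_continuous_within by (metis continuous_at_imp_continuous_on)
  then have "bdd_below (f ` X)"
    using compact_X by (meson bounded_imp_bdd_below compact_continuous_image compact_imp_bounded)
  then show "z \<in> X \<Longrightarrow> (INF y\<in>X. f y) \<le> f z" by (rule cINF_lower)
qed

text \<open>
  Since the windows are consecutive, their decreases telescope as well.
\<close>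

lemma gap_sum_bound:
  assumes \<mu>: "\<mu> \<ge> 1" and K: "K > 0" and cover: "\<And>n. I = (\<Union>k\<in>{n..n+K-1}. B k)"
  shows "(\<Sum>p<n. gap_sum I (p * K) + repeated_gaps I H f LMO B x K (p * K))
    \<le> \<mu> * (f (x 0) - (INF z\<in>X. f z)) + real n * (real K * L * (diameter X)\<^sup>2) / \<mu>"
proof -
  have "(\<Sum>p<n. gap_sum I (p * K) + repeated_gaps I H f LMO B x K (p * K))
      \<le> (\<Sum>p<n. \<mu> * (f (x (p * K)) - f (x (Suc p * K))) + real K * (L * (diameter X)\<^sup>2 / \<mu>))"
    using window_bound[OF \<mu> K cover, of "_ * K"] by (intro sum_mono) (simp add: add.commute)
  also have "\<dots> = \<mu> * (f (x 0) - f (x (n * K))) + real n * (real K * L * (diameter X)\<^sup>2) / \<mu>"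
    using sum_lessThan_telescope'[of "\<lambda>p. f (x (p * K))" n]
    by (simp add: sum.distrib sum_distrib_left[symmetric])
  also have "\<mu> * (f (x 0) - f (x (n * K))) \<le> \<mu> * (f (x 0) - (INF z\<in>X. f z))"
    using INF_le[OF iterate_in] \<mu> by (intro mult_left_mono) auto
  finally show ?thesis by simp
qed

text \<open>
  Along a sequence of feasible points with vanishing gap, the inequality
  \<open>gradient f y \<bullet> (y - v) \<le> gap\<close> passes to the limit for each fixed \<open>v\<close>, because the gradient
  is continuous on the closed set \<open>X\<close>.
\<close>

lemma stationary_limit:
  assumes y: "\<And>k. y k \<in> X" "y \<longlonglongrightarrow> z"
    and gap0: "(\<lambda>k. frank_wolfe_gap I H f LMO I (y k)) \<longlonglongrightarrow> 0"
  shows "stationary_point f X z"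
proof -
  have z: "z \<in> X"
    using closed_sequentially[OF compact_imp_closed[OF compact_X]] y by blast
  have grad: "(\<lambda>k. gradient f (y k)) \<longlonglongrightarrow> gradient f z"
    using lipschitz_on_continuous_on[OF smooth] y z
    by (simp add: continuous_on_sequentially o_def)
  have "gradient f z \<bullet> (z - v) \<le> 0" if v: "v \<in> X" for v
  proof (rule LIMSEQ_le[OF _ gap0])
    show "(\<lambda>k. gradient f (y k) \<bullet> (y k - v)) \<longlonglongrightarrow> gradient f z \<bullet> (z - v)"
      by (intro tendsto_intros grad y)
  qed (use inner_le_frank_wolfe_gap[OF v] in blast)
  then show ?thesis
    unfolding stationary_point_def using z by (auto intro!: cSUP_least)
qed

end

section \<open>Rates and stationarity\<close>

theorem theorem3p1:
  fixes m K :: nat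
    and H C\<^sub>i :: "nat \<Rightarrow> 'a::{real_inner,banach} set"
    and C :: "'a set"
    and f :: "'a \<Rightarrow> real"
    and L D H\<^sub>0 :: real
    and LMO :: "nat set \<Rightarrow> 'a \<Rightarrow> 'a"
    and B :: "nat \<Rightarrow> nat set"
    and x :: "nat \<Rightarrow> 'a"
    and G :: "'a \<Rightarrow> real"
    and A :: "nat \<Rightarrow> real"
  assumes direct_sum: "orthogonal_direct_sum {1..m} H"
    and sets: "\<And>i. i \<in> {1..m} \<Longrightarrow>
      C\<^sub>i i \<subseteq> H i \<and> C\<^sub>i i \<noteq> {} \<and> compact (C\<^sub>i i) \<and> convex (C\<^sub>i i)"
    and C_def: "C = block_product {1..m} H C\<^sub>i {1..m}"
    and D_def: "D = diameter C"
    and f_diff: "\<And>z. f differentiable (at z)"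
    and L_pos: "L > 0"
    and f_smooth: "L-lipschitz_on C (gradient f)"
    and lmo: "linear_minimization_oracle {1..m} H C\<^sub>i LMO"
    and algorithm: "short_step_bcfw {1..m} H C\<^sub>i f L LMO B x"
    and K_pos: "K > 0"
    and cover: "\<And>t. {1..m} = (\<Union>k\<in>{t..t+K-1}. B k)"
    and H\<^sub>0_def: "H\<^sub>0 = f (x 0) - (INF z\<in>C. f z)"
    and G_def: "G = frank_wolfe_gap {1..m} H f LMO {1..m}"
    and A_def: "A = repeated_gaps {1..m} H f LMO B x K"
  shows "(\<forall>n. A n \<ge> 0) \<and>
    (\<forall>n>0.
      Min ((\<lambda>p. G (x (p * K))) ` {0..n-1}) \<le> (1 / real n) * (\<Sum>p=0..n-1. G (x (p * K))) \<and>
      (1 / real n) * (\<Sum>p=0..n-1. G (x (p * K)))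
        \<le> (if real n \<le> 2 * H\<^sub>0 / (real K * L * D\<^sup>2)
           then (2 * H\<^sub>0 - (\<Sum>p=0..n-1. A (p * K))) / real n + real K * L * D\<^sup>2 / 2
           else 2 * D * sqrt (H\<^sub>0 * real K * L / real n) - (\<Sum>p=0..n-1. A (p * K)) / real n)) \<and>
    (\<exists>r. strict_mono r \<and>
      (\<lambda>k. G (x (r k * K))) \<longlonglongrightarrow> 0 \<and>
      (\<forall>z. accumulation_point (\<lambda>k. x (r k * K)) z \<longrightarrow> stationary_point f C z))"
proof -
  interpret short_step_run "{1..m}" H C\<^sub>i LMO f L B x
    by unfold_locales (use direct_sum sets lmo f_diff L_pos f_smooth algorithm C_def in auto)
  have "X = C" by (simp add: C_def)
  \<comment> \<open>The second version has the index set in its normal form \<open>{Suc 0..m}\<close>.\<close>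
  note X = this this[simplified]
  define M where "M = real K * L * D\<^sup>2"
  have M: "M \<ge> 0" using L_pos by (simp add: M_def)
  have D: "D \<ge> 0"
    using diameter_ge_0[OF compact_imp_bounded[OF compact_X]] by (simp only: D_def X)
  have H\<^sub>0: "H\<^sub>0 \<ge> 0" using INF_le[OF iterate_in[of 0]] by (simp add: H\<^sub>0_def X)
  have A_nonneg: "A n \<ge> 0" for n
    unfolding A_def by (rule repeated_gaps_nonneg)
  have G_nonneg: "G (x t) \<ge> 0" for t
    unfolding G_def by (rule frank_wolfe_gap_nonneg[OF subset_refl iterate_in])
  have total: "(\<Sum>p<n. G (x (p * K)) + A (p * K)) \<le> \<mu> * H\<^sub>0 + real n * M / \<mu>"
    if "\<mu> \<ge> 1" for n \<mu>
    using gap_sum_bound[OF that K_pos cover, of n]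
    by (simp add: G_def A_def H\<^sub>0_def M_def D_def X)

  have min_le: "Min ((\<lambda>p. G (x (p * K))) ` {0..n-1}) \<le> (1 / real n) * (\<Sum>p=0..n-1. G (x (p * K)))"
    if n: "n > 0" for n
  proof -
    have "real (card {0..n-1}) * Min ((\<lambda>p. G (x (p * K))) ` {0..n-1})
        \<le> (\<Sum>p=0..n-1. G (x (p * K)))"
      by (rule sum_bounded_below) (rule Min_le, auto)
    then show ?thesis using n by (simp add: field_simps)
  qed

  have rate: "(1 / real n) * (\<Sum>p=0..n-1. G (x (p * K)))
      \<le> (if real n \<le> 2 * H\<^sub>0 / (real K * L * D\<^sup>2)
         then (2 * H\<^sub>0 - (\<Sum>p=0..n-1. A (p * K))) / real n + real K * L * D\<^sup>2 / 2
         else 2 * D * sqrt (H\<^sub>0 * real K * L / real n) - (\<Sum>p=0..n-1. A (p * K)) / real n)"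
    if n: "n > 0" for n
  proof -
    define SG SA where "SG = (\<Sum>p=0..n-1. G (x (p * K)))" and "SA = (\<Sum>p=0..n-1. A (p * K))"
    have "{..<n} = {0..n-1}" using n by auto
    with total[of _ n] have bound: "SG + SA \<le> \<mu> * H\<^sub>0 + real n * M / \<mu>" if "\<mu> \<ge> 1" for \<mu>
      using that by (simp add: SG_def SA_def sum.distrib)
    show ?thesis
    proof (cases "real n \<le> 2 * H\<^sub>0 / M")
      case True
      have "SG \<le> 2 * H\<^sub>0 - SA + real n * (M / 2)" using bound[of 2] by simp
      then have "(1 / real n) * SG \<le> (2 * H\<^sub>0 - SA) / real n + M / 2"
        using n by (simp add: field_simps)
      with True show ?thesis by (simp add: SG_def SA_def M_def)
    next
      case False
      have "H\<^sub>0 \<le> real n * M"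
      proof (cases "M = 0")
        case True
        \<comment> \<open>The division by zero puts this case into the second branch; here \<open>C\<close> is a single point.\<close>
        then have "diameter X = 0" using L_pos K_pos by (simp add: M_def D_def X)
        then have "y = x 0" if "y \<in> X" for y
          using diameter_bounded_bound[OF compact_imp_bounded[OF compact_X] that iterate_in[of 0]]
          by simp
        then have "X = {x 0}" using iterate_in[of 0] by blast
        then show ?thesis using True by (simp add: H\<^sub>0_def X)
      next
        case False
        with M \<open>\<not> real n \<le> 2 * H\<^sub>0 / M\<close> have "2 * H\<^sub>0 < real n * M" by (simp add: field_simps)
        with H\<^sub>0 show ?thesis by linarith
      qed
      then have "SG + SA \<le> 2 * sqrt (H\<^sub>0 * (real n * M))"
        by (intro le_two_sqrt_of_le_weighted bound H\<^sub>0) auto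
      also have "H\<^sub>0 * (real n * M) = (real n * D)\<^sup>2 * (H\<^sub>0 * real K * L / real n)"
        using n by (simp add: M_def field_simps power2_eq_square)
      also have "sqrt \<dots> = real n * D * sqrt (H\<^sub>0 * real K * L / real n)"
        unfolding real_sqrt_mult[of "(real n * D)\<^sup>2"] real_sqrt_abs using D by simp
      finally have "SG \<le> real n * (2 * D * sqrt (H\<^sub>0 * real K * L / real n)) - SA" by simp
      then have "(1 / real n) * SG \<le> 2 * D * sqrt (H\<^sub>0 * real K * L / real n) - SA / real n"
        using n by (simp add: field_simps)
      with False show ?thesis by (simp add: SG_def SA_def M_def)
    qed
  qed

  have "\<exists>r. strict_mono r \<and> (\<lambda>k. G (x (r k * K))) \<longlonglongrightarrow> 0"
  proof (rule vanishing_subsequence[OF G_nonneg _ M])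
    fix \<mu> :: real and n :: nat assume "\<mu> \<ge> 1"
    have "(\<Sum>p<n. G (x (p * K))) \<le> (\<Sum>p<n. G (x (p * K)) + A (p * K))"
      using A_nonneg by (intro sum_mono) simp
    with total[OF \<open>\<mu> \<ge> 1\<close>, of n]
    show "(\<Sum>p<n. G (x (p * K))) \<le> \<mu> * H\<^sub>0 + real n * M / \<mu>" by linarith
  qed
  then obtain r where r: "strict_mono r" "(\<lambda>k. G (x (r k * K))) \<longlonglongrightarrow> 0" by blast
  have "stationary_point f C z" if "accumulation_point (\<lambda>k. x (r k * K)) z" for z
  proof -
    obtain s where s: "strict_mono s" "((\<lambda>k. x (r k * K)) \<circ> s) \<longlonglongrightarrow> z"
      using \<open>accumulation_point _ z\<close> unfolding accumulation_point_def by blast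
    have "(\<lambda>k. G (x (r (s k) * K))) \<longlonglongrightarrow> 0"
      using LIMSEQ_subseq_LIMSEQ[OF r(2) s(1)] by (simp add: o_def)
    then show ?thesis
      using stationary_limit[OF iterate_in, of "\<lambda>k. r (s k) * K" z] s(2)
      by (simp add: o_def G_def X)
  qed
  with r min_le rate A_nonneg show ?thesis by blast
qed

end
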